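(* For every irreducible reversible Markov chain with a finite state space $V$ and every $\ell\in\mathbb N=\{1,2,\ldots\}$: (1) for all $\varepsilon>0$, $$t_{\mathrm{ave-mix}}^{(2)}(\varepsilon)\le \tfrac12\, t_{\mathrm{rel}}\max\left\{\log\left(\varepsilon^{-2}\mathcal Q_\ell/t_{\mathrm{rel}}^{\ell}\right),\ \ell\right\};$$ (2) for all $x\in V$ and all $\varepsilon>0$, $$t_{\mathrm{mix}}^{(2),x}(\varepsilon)\le\tfrac12\, t_{\mathrm{rel}}\max\left\{\log\left(\varepsilon^{-2}\sigma_{x,\ell}/t_{\mathrm{rel}}^{\ell}\right),\ \ell\right\};$$ (3) for all $\varepsilon>0$, $$t_{\mathrm{mix}}^{(\infty)}(\varepsilon)\le t_{\mathrm{rel}}\max\left\{\log\left(\varepsilon^{-1}\sigma_{\ell}/t_{\mathrm{rel}}^{\ell}\right),\ \ell\right\},\qquad\text{where }\ \sigma_\ell:=\max_{x\in V}\sigma_{x,\ell}.$$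
   Context: $P$ is the transition matrix of an irreducible Markov chain on a finite state space $V$ of size $n\ge2$, reversible with respect to its stationary distribution $\pi$. The continuous-time rate 1 version has heat kernel $H_t:=e^{-t(I-P)}$. The eigenvalues of $I-P$ are $0=\lambda_1<\lambda_2\le\cdots\le\lambda_n\le2$ and $t_{\mathrm{rel}}:=1/\lambda_2$. For $\ell\in\mathbb N$: $$\mathcal Q_\ell:=\sum_{i=2}^n\frac1{\lambda_i^\ell},\qquad \sigma_{x,\ell}:=\int_0^\infty\frac{s^{\ell-1}\left(H_s(x,x)-\pi(x)\right)}{(\ell-1)!\,\pi(x)}\,\mathrm ds .$$ Mixing times: for $\varepsilon>0$, $t_{\mathrm{mix}}^{(\infty)}(\varepsilon):=\inf\{t\ge0:\max_{a,b\in V}|H_t(a,b)/\pi(b)-1|\le\varepsilon\}$; $t_{\mathrm{mix}}^{(2),x}(\varepsilon):=\inf\{t\ge0: H_{2t}(x,x)/\pi(x)-1\le\varepsilon^2\}$; $t_{\mathrm{ave-mix}}^{(2)}(\varepsilon):=\inf\{t\ge0:\sum_{x\in V}H_{2t}(x,x)\le 1+\varepsilon^2\}$. *)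

theory Defs
  imports "HOL-Analysis.Analysis" "HOL-Computational_Algebra.Polynomial"
begin

text \<open>
  The state space is the finite index type \<open>'v\<close>, and \<open>P $ x $ y\<close> is the probability
  of moving from \<open>x\<close> to \<open>y\<close>.
\<close>

definition matrix_power :: "real^'v^'v \<Rightarrow> nat \<Rightarrow> real^'v^'v" where
  "matrix_power A k = (((**) A) ^^ k) (mat 1)"

definition transition_matrix :: "real^'v^'v \<Rightarrow> bool" where
  "transition_matrix P \<longleftrightarrow>
     (\<forall>x y. 0 \<le> P $ x $ y) \<and> (\<forall>x. (\<Sum>y\<in>UNIV. P $ x $ y) = 1)"

definition irreducible_chain :: "real^'v^'v \<Rightarrow> bool" where
  "irreducible_chain P \<longleftrightarrow> (\<forall>x y. \<exists>k. matrix_power P k $ x $ y > 0)"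

definition stationary_distribution :: "real^'v \<Rightarrow> real^'v^'v \<Rightarrow> bool" where
  "stationary_distribution \<pi> P \<longleftrightarrow>
     (\<forall>x. 0 \<le> \<pi> $ x) \<and> (\<Sum>x\<in>UNIV. \<pi> $ x) = 1 \<and> \<pi> v* P = \<pi>"

definition reversible_chain :: "real^'v \<Rightarrow> real^'v^'v \<Rightarrow> bool" where
  "reversible_chain \<pi> P \<longleftrightarrow> (\<forall>x y. \<pi> $ x * P $ x $ y = \<pi> $ y * P $ y $ x)"

definition matrix_exp :: "real^'v^'v \<Rightarrow> real^'v^'v" where
  "matrix_exp A = (\<Sum>k. matrix_power A k /\<^sub>R fact k)"

definition heat_kernel :: "real^'v^'v \<Rightarrow> real \<Rightarrow> real^'v^'v" where
  "heat_kernel P t = matrix_exp ((- t) *\<^sub>R (mat 1 - P))"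

definition characteristic_poly :: "real^'v^'v \<Rightarrow> real poly" where
  "characteristic_poly A = det (\<chi> i j. (if i = j then [:0, 1:] else 0) - [:A $ i $ j:])"

text \<open>
  The real eigenvalues in increasing order, repeated according to algebraic multiplicity.
  For the matrices \<open>mat 1 - P\<close> considered here, with \<open>P\<close> reversible, all eigenvalues
  are real and the list has length \<open>CARD('v)\<close>.
\<close>

definition eigenvalue_list :: "real^'v^'v \<Rightarrow> real list" where
  "eigenvalue_list A = sorted_list_of_multiset (proots (characteristic_poly A))"

text \<open>Indices start at 1: \<open>eigval P 1\<close> is the smallest eigenvalue of \<open>mat 1 - P\<close>.\<close>

definition eigval :: "real^'v^'v \<Rightarrow> nat \<Rightarrow> real" where
  "eigval P i = eigenvalue_list (mat 1 - P) ! (i - 1)"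

definition t_rel :: "real^'v^'v \<Rightarrow> real" where
  "t_rel P = 1 / eigval P 2"

definition Q_sum :: "real^'v^'v \<Rightarrow> nat \<Rightarrow> real" where
  "Q_sum P l = (\<Sum>i = 2..CARD('v). 1 / eigval P i ^ l)"

definition sigma_at :: "real^'v \<Rightarrow> real^'v^'v \<Rightarrow> 'v \<Rightarrow> nat \<Rightarrow> real" where
  "sigma_at \<pi> P x l =
     (LBINT s:{0..}. s ^ (l - 1) * (heat_kernel P s $ x $ x - \<pi> $ x) / (fact (l - 1) * \<pi> $ x))"

definition sigma_max :: "real^'v \<Rightarrow> real^'v^'v \<Rightarrow> nat \<Rightarrow> real" where
  "sigma_max \<pi> P l = Max (range (\<lambda>x. sigma_at \<pi> P x l))"

definition t_mix_inf :: "real^'v \<Rightarrow> real^'v^'v \<Rightarrow> real \<Rightarrow> real" where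
  "t_mix_inf \<pi> P \<epsilon> =
     Inf {t. 0 \<le> t \<and> Max (range (\<lambda>(a, b). \<bar>heat_kernel P t $ a $ b / \<pi> $ b - 1\<bar>)) \<le> \<epsilon>}"

definition t_mix_2 :: "real^'v \<Rightarrow> real^'v^'v \<Rightarrow> 'v \<Rightarrow> real \<Rightarrow> real" where
  "t_mix_2 \<pi> P x \<epsilon> =
     Inf {t. 0 \<le> t \<and> heat_kernel P (2 * t) $ x $ x / \<pi> $ x - 1 \<le> \<epsilon>\<^sup>2}"

definition t_ave_mix_2 :: "real^'v^'v \<Rightarrow> real \<Rightarrow> real" where
  "t_ave_mix_2 P \<epsilon> =
     Inf {t. 0 \<le> t \<and> (\<Sum>x\<in>UNIV. heat_kernel P (2 * t) $ x $ x) \<le> 1 + \<epsilon>\<^sup>2}"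

end

theory Submission
  imports Defs "HOL-Probability.Distributions"
begin

text \<open>
  In an orthonormal basis \<open>f\<^sub>i\<close> of \<open>L\<^sup>2(\<pi>)\<close> of eigenfunctions of \<open>I - P\<close>, with
  eigenvalues \<open>\<mu>\<^sub>i\<close>, all quantities are spectral sums over the nonzero eigenvalues:
  \<open>H\<^sub>t(x,y) / \<pi>(y) - 1 = \<Sum> exp (- \<mu>\<^sub>i t) f\<^sub>i(x) f\<^sub>i(y)\<close> and
  \<open>\<sigma>\<^sub>x\<^sub>,\<^sub>l = \<Sum> f\<^sub>i(x)\<^sup>2 / \<mu>\<^sub>i\<^sup>l\<close>, the latter by the Gamma integral. For \<open>t \<ge> l t\<^sub>r\<^sub>e\<^sub>l\<close> the
  function \<open>s \<mapsto> s\<^sup>l exp (- s t)\<close> is decreasing on \<open>s \<ge> 1 / t\<^sub>r\<^sub>e\<^sub>l\<close>, so every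
  \<open>exp (- \<mu>\<^sub>i t)\<close> is at most \<open>exp (- t / t\<^sub>r\<^sub>e\<^sub>l) / (\<mu>\<^sub>i t\<^sub>r\<^sub>e\<^sub>l)\<^sup>l\<close>. Summing over \<open>i\<close> bounds the
  diagonal terms by \<open>exp (- t / t\<^sub>r\<^sub>e\<^sub>l) \<sigma>\<^sub>x\<^sub>,\<^sub>l / t\<^sub>r\<^sub>e\<^sub>l\<^sup>l\<close> and the trace by the analogous
  expression in \<open>Q\<^sub>l\<close>; off-diagonal terms are dominated by diagonal ones.
\<close>

section \<open>Self-adjoint maps and symmetric matrices\<close>

text \<open>A maximiser \<open>v\<close> of the Rayleigh quotient on the unit sphere of
  \<open>W\<close> is an eigenvector: the form \<open>g\<close> is nonnegative on \<open>W\<close>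
  and vanishes at \<open>v\<close>, so its first variation along the residual \<open>h\<close>, a
  multiple of \<open>h \<bullet> h\<close>, must vanish.\<close>

lemma self_adjoint_has_eigenvector:
  fixes f :: "'a::euclidean_space \<Rightarrow> 'a"
  assumes lin: "linear f" and sym: "\<And>x y. f x \<bullet> y = x \<bullet> f y"
    and W: "subspace W" "f ` W \<subseteq> W" "W \<noteq> {0}"
  obtains v c where "v \<in> W" "norm v = 1" "f v = c *\<^sub>R v"
proof -
  interpret linear f by fact
  have cont: "continuous_on UNIV f"
    using lin by (simp add: linear_continuous_on linear_conv_bounded_linear)
  obtain w where w: "w \<in> W" "w \<noteq> 0"
    using W subspace_0 by blast
  have "compact (sphere 0 1 \<inter> W)"
    using W closed_subspace by (intro compact_Int_closed) auto
  moreover have "(1 / norm w) *\<^sub>R w \<in> sphere 0 1 \<inter> W"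
    using w W by (auto simp: subspace_scale)
  moreover have "continuous_on (sphere 0 1 \<inter> W) (\<lambda>x. x \<bullet> f x)"
    by (intro continuous_intros continuous_on_subset[OF cont]) auto
  ultimately obtain v where "v \<in> sphere 0 1 \<inter> W"
    and vmax: "\<And>x. x \<in> sphere 0 1 \<inter> W \<Longrightarrow> x \<bullet> f x \<le> v \<bullet> f v"
    using continuous_attains_sup[of "sphere 0 1 \<inter> W" "\<lambda>x. x \<bullet> f x"] by blast
  then have v: "v \<in> W" "norm v = 1"
    by auto
  define c where "c = v \<bullet> f v"
  define g where "g x = c * (x \<bullet> x) - x \<bullet> f x" for x
  have g_nonneg: "0 \<le> g x" if "x \<in> W" for x
  proof (cases "x = 0")
    case False
    have "(1 / norm x) *\<^sub>R x \<bullet> f ((1 / norm x) *\<^sub>R x) \<le> c"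
      unfolding c_def using that W False by (intro vmax) (auto simp: subspace_scale)
    then show ?thesis
      using False
      by (simp add: g_def scale power2_eq_square[symmetric] divide_le_eq flip: power2_norm_eq_inner)
  qed (simp add: g_def)
  define h where "h = c *\<^sub>R v - f v"
  have hW: "h \<in> W"
    using v W by (auto simp: h_def intro!: subspace_diff subspace_scale)
  have quad: "g (v + t *\<^sub>R h) = 2 * t * (h \<bullet> h) + t\<^sup>2 * g h" for t
  proof -
    have "v \<bullet> v = 1"
      using v by (simp add: norm_eq_1)
    then show ?thesis
      using sym[of v h]
      by (simp add: g_def h_def add scale diff inner_simps c_def inner_commute power2_eq_square
          algebra_simps)
  qed
  have "h \<bullet> h = 0"
  proof (rule ccontr)
    assume "h \<bullet> h \<noteq> 0"
    then have hh: "h \<bullet> h > 0" by simp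
    \<comment> \<open>Minimises \<open>2 * t * (h \<bullet> h) + t\<^sup>2 * (g h + 1)\<close>;
      adding 1 keeps the leading coefficient positive even when \<open>g h = 0\<close>.\<close>
    define t where "t = - (h \<bullet> h) / (g h + 1)"
    have gh: "g h + 1 > 0" using g_nonneg[OF hW] by simp
    have "0 \<le> g (v + t *\<^sub>R h)"
      using v hW W by (intro g_nonneg subspace_add subspace_scale)
    also have "g (v + t *\<^sub>R h) \<le> 2 * t * (h \<bullet> h) + t\<^sup>2 * (g h + 1)"
      unfolding quad by (simp add: algebra_simps)
    also have "\<dots> = - ((h \<bullet> h)\<^sup>2 / (g h + 1))"
    proof -
      have "2 * (- a / k) * a + (- a / k)\<^sup>2 * k = - (a\<^sup>2 / k)" if "k > 0" for a k :: real
        using that by (simp add: field_simps power2_eq_square)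
      from this[OF gh, of "h \<bullet> h"] show ?thesis
        by (simp add: t_def)
    qed
    also have "\<dots> < 0"
      using hh gh by simp
    finally show False by simp
  qed
  then have "f v = c *\<^sub>R v"
    by (simp add: h_def)
  then show ?thesis using that v by blast
qed

text \<open>Induction on the dimension, splitting off one unit eigenvector at a time. General
  invariant subspaces are needed because the step passes to the orthogonal complement
  \<open>W'\<close>, invariant by self-adjointness.\<close>

lemma self_adjoint_orthonormal_eigenbasis:
  fixes f :: "'a::euclidean_space \<Rightarrow> 'a"
  assumes lin: "linear f" and sym: "\<And>x y. f x \<bullet> y = x \<bullet> f y"
    and W: "subspace W" "f ` W \<subseteq> W"
  shows "\<exists>B\<subseteq>W. finite B \<and> card B = dim W \<and> pairwise orthogonal B \<and>
           (\<forall>b\<in>B. norm b = 1 \<and> (\<exists>c. f b = c *\<^sub>R b))"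
  using W
proof (induction "dim W" arbitrary: W)
  case 0
  then show ?case by (intro exI[of _ "{}"]) auto
next
  case (Suc n)
  interpret linear f by fact
  have "W \<noteq> {0}" using Suc.hyps(2) by (metis Zero_not_Suc dim_eq_0 order_refl)
  then obtain v c where v: "v \<in> W" "norm v = 1" "f v = c *\<^sub>R v"
    using self_adjoint_has_eigenvector[OF lin sym Suc.prems] by blast
  define W' where "W' = {w \<in> W. orthogonal v w}"
  \<comment> \<open>The form that \<open>dim_subspace_orthogonal_to_vectors\<close> expects, with a
    span in place of the single vector.\<close>
  have W'_eq: "W' = {y \<in> W. \<forall>x \<in> span {v}. orthogonal x y}"
    unfolding W'_def
    by (auto simp: span_singleton orthogonal_def dest: spec[of _ v] intro: bexI[of _ v] span_base)
  have sub': "subspace W'"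
    using Suc.prems(1) unfolding subspace_def W'_def by (auto simp: orthogonal_def inner_simps)
  have "v \<noteq> 0" using v by auto
  then have "dim (span {v}) = 1"
    by (simp add: dim_span dim_singleton)
  moreover have "dim W' + dim (span {v}) = dim W"
    unfolding W'_eq using Suc.prems v
    by (intro dim_subspace_orthogonal_to_vectors subspace_span) (auto intro: span_minimal subsetD[OF span_minimal])
  ultimately have dW': "dim W = Suc (dim W')" by simp
  have inv': "f ` W' \<subseteq> W'"
  proof
    fix y assume "y \<in> f ` W'"
    then obtain w where w: "w \<in> W" "orthogonal v w" "y = f w" by (auto simp: W'_def)
    have "v \<bullet> f w = c * (v \<bullet> w)" using sym[of v w] v by simp
    then show "y \<in> W'" using w Suc.prems by (auto simp: W'_def orthogonal_def)
  qed
  obtain B where B: "B \<subseteq> W'" "finite B" "card B = dim W'" "pairwise orthogonal B"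
      "\<forall>b\<in>B. norm b = 1 \<and> (\<exists>c. f b = c *\<^sub>R b)"
    using Suc.hyps(1)[OF _ sub' inv'] Suc.hyps(2) dW' by auto
  have "v \<notin> B"
    using B(1) \<open>v \<noteq> 0\<close> by (auto simp: W'_def orthogonal_def)
  then show ?case
    using B v dW' by (intro exI[of _ "insert v B"])
      (auto simp: W'_def pairwise_insert orthogonal_commute)
qed

text \<open>The third property, completeness, follows from the second: a left inverse of the matrix
  \<open>U\<close> with columns \<open>u i\<close> is also a right inverse. Indexing the basis by
  \<open>'n\<close> makes \<open>U\<close> square.\<close>

lemma symmetric_matrix_orthonormal_eigenvectors:
  fixes A :: "real^'n^'n"
  assumes "transpose A = A"
  obtains u :: "'n \<Rightarrow> real^'n" and \<mu> :: "'n \<Rightarrow> real"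
  where "\<And>i. A *v u i = \<mu> i *\<^sub>R u i"
    "\<And>i j. u i \<bullet> u j = (if i = j then 1 else 0)"
    "\<And>x y. (\<Sum>i\<in>UNIV. u i $ x * u i $ y) = (if x = y then 1 else 0)"
proof -
  have sym: "(A *v x) \<bullet> y = x \<bullet> (A *v y)" for x y
    using dot_lmul_matrix[of x A y] assms by (metis transpose_matrix_vector)
  obtain B where B: "finite B" "card B = DIM(real^'n)" "pairwise orthogonal B"
      "\<And>b. b \<in> B \<Longrightarrow> norm b = 1" "\<And>b. b \<in> B \<Longrightarrow> \<exists>c. A *v b = c *\<^sub>R b"
    using self_adjoint_orthonormal_eigenbasis[OF matrix_vector_mul_linear[of A] sym subspace_UNIV]
    by (auto simp: dim_UNIV)
  have "card B = CARD('n)" using B(2) by simp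
  then obtain u where u: "bij_betw u (UNIV :: 'n set) B"
    using finite_same_card_bij[of "UNIV :: 'n set" B] B(1) by auto
  have uB: "u i \<in> B" for i using u by (auto simp: bij_betw_def)
  obtain \<mu> where \<mu>: "\<And>i. A *v u i = \<mu> i *\<^sub>R u i"
    using B(5)[OF uB] by metis
  have orth: "u i \<bullet> u j = (if i = j then 1 else 0)" for i j
  proof (cases "i = j")
    case False
    then have "u i \<noteq> u j" using u by (auto simp: bij_betw_def inj_on_def)
    then show ?thesis using B(3) uB False by (auto simp: pairwise_def orthogonal_def)
  qed (use B(4)[OF uB] in \<open>simp add: norm_eq_1\<close>)
  define U :: "real^'n^'n" where "U = (\<chi> x i. u i $ x)"
  have "transpose U ** U = mat 1"
    using orth by (simp add: vec_eq_iff matrix_matrix_mult_def U_def transpose_def mat_def inner_vec_def)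
  then have "U ** transpose U = mat 1"
    using matrix_left_right_inverse by blast
  then have "(\<Sum>i\<in>UNIV. u i $ x * u i $ y) = (if x = y then 1 else 0)" for x y
    by (simp add: vec_eq_iff matrix_matrix_mult_def U_def transpose_def mat_def)
  with \<mu> orth that show ?thesis by blast
qed

section \<open>Diagonalizable matrices\<close>

text \<open>The eigenvector equations become \<open>?X ** C M = C M ** D\<close> over the
  polynomials, with \<open>C\<close> embedding constants and \<open>D\<close> diagonal. Determinants
  are multiplicative, and \<open>det (C M)\<close>, a divisor of 1, can be cancelled.\<close>

lemma characteristic_poly_diagonalizable:
  fixes A M N :: "real^'n^'n"
  assumes eig: "\<And>x i. (\<Sum>z\<in>UNIV. A $ x $ z * M $ z $ i) = \<mu> i * M $ x $ i"
    and inv: "M ** N = mat 1"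
  shows "characteristic_poly A = (\<Prod>i\<in>UNIV. [:- \<mu> i, 1:])"
proof -
  define C :: "real^'n^'n \<Rightarrow> real poly^'n^'n" where "C X = (\<chi> i j. [:X $ i $ j:])" for X
  define D :: "real poly^'n^'n" where "D = (\<chi> i j. if i = j then [:- \<mu> i, 1:] else 0)"
  have const_sum: "(\<Sum>z\<in>S. [:h z:]) = [:\<Sum>z\<in>S. h z:]" for S :: "'n set" and h :: "'n \<Rightarrow> real"
    by (induction S rule: infinite_finite_induct) auto
  have "C M ** C N = C (M ** N)"
    by (simp add: C_def vec_eq_iff matrix_matrix_mult_def const_sum mult.commute)
  also have "\<dots> = mat 1"
    unfolding inv by (simp add: C_def vec_eq_iff mat_def one_pCons)
  finally have "det (C M) * det (C N) = 1"
    by (metis det_mul det_I)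
  then have nz: "det (C M) \<noteq> 0" by auto
  let ?X = "(\<chi> i j. (if i = j then [:0, 1:] else 0) - [:A $ i $ j:]) :: real poly^'n^'n"
  have "?X ** C M = C M ** D"
  proof -
    have "(\<Sum>z\<in>UNIV. ((if x = z then [:0, 1:] else 0) - [:A $ x $ z:]) * [:M $ z $ i:])
        = (\<Sum>z\<in>UNIV. [:M $ x $ z:] * (if z = i then [:- \<mu> z, 1:] else 0))" for x i
    proof -
      have "(\<Sum>z\<in>UNIV. ((if x = z then [:0, 1:] else 0) - [:A $ x $ z:]) * [:M $ z $ i:])
        = (\<Sum>z\<in>UNIV. if x = z then [:0, 1:] * [:M $ z $ i:] else 0) - (\<Sum>z\<in>UNIV. [:A $ x $ z * M $ z $ i:])"
        unfolding sum_subtractf[symmetric] by (intro sum.cong) (auto simp: algebra_simps)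
      also have "\<dots> = [:0, 1:] * [:M $ x $ i:] - [:\<mu> i * M $ x $ i:]"
        by (simp add: const_sum eig)
      also have "\<dots> = [:M $ x $ i:] * [:- \<mu> i, 1:]"
        by simp
      finally show ?thesis by (simp add: if_distrib[of "\<lambda>p. q * p" for q] cong: if_cong)
    qed
    then show ?thesis
      by (simp add: vec_eq_iff matrix_matrix_mult_def C_def D_def)
  qed
  then have "det (?X ** C M) = det (C M ** D)"
    by (rule arg_cong)
  then have "det ?X * det (C M) = det (C M) * det D"
    unfolding det_mul .
  then have "det ?X = det D" using nz by simp
  also have "det D = (\<Prod>i\<in>UNIV. D $ i $ i)"
    by (rule det_diagonal) (simp add: D_def)
  finally show ?thesis
    by (simp add: characteristic_poly_def D_def)
qed

text \<open>The rank-one matrices do not depend on \<open>k\<close>, so the exponential series can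
  be summed coefficientwise in the next lemma.\<close>

lemma matrix_power_diagonalizable:
  fixes A M N :: "real^'n^'n"
  assumes eig: "\<And>x i. (\<Sum>z\<in>UNIV. A $ x $ z * M $ z $ i) = \<mu> i * M $ x $ i"
    and inv: "M ** N = mat 1"
  shows "matrix_power A k = (\<Sum>i\<in>UNIV. \<mu> i ^ k *\<^sub>R (\<chi> x y. M $ x $ i * N $ i $ y))"
proof (induction k)
  case 0
  then show ?case
    using inv by (simp add: matrix_power_def vec_eq_iff matrix_matrix_mult_def)
next
  case (Suc k)
  have "matrix_power A (Suc k) $ x $ y
      = (\<Sum>i\<in>UNIV. \<mu> i ^ Suc k * (M $ x $ i * N $ i $ y))" for x y
  proof -
    have "matrix_power A (Suc k) $ x $ y = (\<Sum>z\<in>UNIV. A $ x $ z * matrix_power A k $ z $ y)"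
      by (simp add: matrix_power_def matrix_matrix_mult_def)
    also have "\<dots> = (\<Sum>z\<in>UNIV. \<Sum>i\<in>UNIV. A $ x $ z * (\<mu> i ^ k * (M $ z $ i * N $ i $ y)))"
      by (simp add: Suc sum_distrib_left)
    also have "\<dots> = (\<Sum>i\<in>UNIV. \<mu> i ^ k * N $ i $ y * (\<Sum>z\<in>UNIV. A $ x $ z * M $ z $ i))"
      unfolding sum_distrib_left by (subst sum.swap) (simp add: mult_ac)
    also have "\<dots> = (\<Sum>i\<in>UNIV. \<mu> i ^ Suc k * (M $ x $ i * N $ i $ y))"
      unfolding eig by (simp add: mult_ac)
    finally show ?thesis .
  qed
  then show ?case by (simp add: vec_eq_iff)
qed

lemma matrix_exp_diagonalizable:
  fixes A M N :: "real^'n^'n"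
  assumes "\<And>x i. (\<Sum>z\<in>UNIV. A $ x $ z * M $ z $ i) = \<mu> i * M $ x $ i"
    and "M ** N = mat 1"
  shows "matrix_exp A $ x $ y = (\<Sum>i\<in>UNIV. exp (\<mu> i) * (M $ x $ i * N $ i $ y))"
proof -
  let ?E = "\<lambda>i. (\<chi> x y. M $ x $ i * N $ i $ y) :: real^'n^'n"
  have "(\<lambda>k. \<Sum>i\<in>UNIV. (\<mu> i ^ k /\<^sub>R fact k) *\<^sub>R ?E i) sums (\<Sum>i\<in>UNIV. exp (\<mu> i) *\<^sub>R ?E i)"
    by (intro sums_sum sums_scaleR_left exp_converges)
  then have "(\<lambda>k. matrix_power A k /\<^sub>R fact k) sums (\<Sum>i\<in>UNIV. exp (\<mu> i) *\<^sub>R ?E i)"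
    by (simp add: matrix_power_diagonalizable[OF assms] scaleR_sum_right)
  then have "matrix_exp A = (\<Sum>i\<in>UNIV. exp (\<mu> i) *\<^sub>R ?E i)"
    unfolding matrix_exp_def by (rule sums_unique[symmetric])
  then show ?thesis by simp
qed

section \<open>The Gamma integral\<close>

lemma integral_power_times_exp:
  fixes c :: real
  assumes "c > 0" "l \<ge> 1"
  shows "set_integrable lborel {0..} (\<lambda>s. s ^ (l - 1) * exp (- (c * s)))"
    and "(LBINT s:{0..}. s ^ (l - 1) * exp (- (c * s))) = fact (l - 1) / c ^ l"
proof -
  have nn: "(\<integral>\<^sup>+ s. ennreal (erlang_density (l - 1) c s) \<partial>lborel) = 1"
    using nn_integral_erlang_ith_moment[OF assms(1), of "l - 1" 0] by simp
  have hb: "has_bochner_integral lborel (erlang_density (l - 1) c) 1"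
    using nn assms(1) by (intro has_bochner_integral_nn_integral) auto
  \<comment> \<open>Up to a constant the integrand is the Erlang density, which has mass 1; the case
    split on \<open>l\<close> turns the exponent \<open>Suc (l - 1)\<close> of \<open>c\<close> into
    \<open>l\<close>.\<close>
  have eq: "indicator {0..} s *\<^sub>R (s ^ (l - 1) * exp (- (c * s)))
      = fact (l - 1) / c ^ l * erlang_density (l - 1) c s" for s
    using assms by (cases l) (auto simp: erlang_density_def indicator_def)
  have "has_bochner_integral lborel (\<lambda>s. indicator {0..} s *\<^sub>R (s ^ (l - 1) * exp (- (c * s))))
      (fact (l - 1) / c ^ l * 1)"
    unfolding eq by (intro has_bochner_integral_mult_right hb)
  then show "set_integrable lborel {0..} (\<lambda>s. s ^ (l - 1) * exp (- (c * s)))"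
    and "(LBINT s:{0..}. s ^ (l - 1) * exp (- (c * s))) = fact (l - 1) / c ^ l"
    by (auto simp: set_integrable_def set_lebesgue_integral_def has_bochner_integral_iff)
qed

section \<open>Spectral expansion of a reversible chain\<close>

lemma matrix_power_nonneg:
  assumes "transition_matrix P"
  shows "0 \<le> matrix_power P k $ x $ y"
proof (induction k arbitrary: x)
  case (Suc k)
  have "matrix_power P (Suc k) $ x $ y = (\<Sum>z\<in>UNIV. P $ x $ z * matrix_power P k $ z $ y)"
    by (simp add: matrix_power_def matrix_matrix_mult_def)
  also have "\<dots> \<ge> 0"
    using assms Suc by (intro sum_nonneg mult_nonneg_nonneg) (auto simp: transition_matrix_def)
  finally show ?case .
qed (simp add: matrix_power_def mat_def)

text \<open>A positive entry of a power of \<open>P\<close> splits into a positive first step and a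
  positive entry of the previous power. Serves both for the positivity of \<open>\<pi>\<close> and
  for the constancy of eigenfunctions with eigenvalue 0.\<close>

lemma irreducible_closed_set_eq_UNIV:
  assumes "transition_matrix P" "irreducible_chain P"
    and "x \<in> S" and closed: "\<And>y z. y \<in> S \<Longrightarrow> 0 < P $ y $ z \<Longrightarrow> z \<in> S"
  shows "S = UNIV"
proof -
  have reach: "y \<in> S" if "x \<in> S" "0 < matrix_power P k $ x $ y" for x y k
    using that
  proof (induction k arbitrary: x)
    case 0
    then show ?case by (auto simp: matrix_power_def mat_def split: if_splits)
  next
    case (Suc k)
    have "0 < (\<Sum>z\<in>UNIV. P $ x $ z * matrix_power P k $ z $ y)"
      using Suc.prems by (simp add: matrix_power_def matrix_matrix_mult_def)
    then obtain z where "0 < P $ x $ z * matrix_power P k $ z $ y"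
      by (meson linorder_not_le sum_nonpos)
    moreover have "0 \<le> P $ x $ z" "0 \<le> matrix_power P k $ z $ y"
      using assms(1) matrix_power_nonneg by (auto simp: transition_matrix_def)
    ultimately have "0 < P $ x $ z" "0 < matrix_power P k $ z $ y"
      by (auto simp: zero_less_mult_iff)
    then show ?case
      using Suc closed by blast
  qed
  then show ?thesis
    using assms(2,3) unfolding irreducible_chain_def by blast
qed

locale reversible_irreducible_chain =
  fixes P :: "real^'v^'v" and \<pi> :: "real^'v"
  assumes transition: "transition_matrix P"
    and irreducible: "irreducible_chain P"
    and stationary: "stationary_distribution \<pi> P"
    and reversible: "reversible_chain \<pi> P"
begin

lemma P_nonneg: "0 \<le> P $ x $ y"
  and P_row_sum: "(\<Sum>y\<in>UNIV. P $ x $ y) = 1"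
  using transition by (auto simp: transition_matrix_def)

lemma \<pi>_nonneg: "0 \<le> \<pi> $ x"
  and \<pi>_sum: "(\<Sum>x\<in>UNIV. \<pi> $ x) = 1"
  using stationary by (auto simp: stationary_distribution_def)

lemma detailed_balance: "\<pi> $ x * P $ x $ y = \<pi> $ y * P $ y $ x"
  using reversible by (auto simp: reversible_chain_def)

text \<open>By detailed balance the support of \<open>\<pi>\<close> is closed under transitions, and
  it is nonempty because \<open>\<pi>\<close> has mass 1.\<close>

lemma \<pi>_pos: "0 < \<pi> $ x"
proof -
  obtain x0 where "0 < \<pi> $ x0"
    using \<pi>_sum \<pi>_nonneg by (metis less_eq_real_def sum.neutral zero_neq_one)
  moreover have "0 < \<pi> $ z" if "0 < \<pi> $ y" "0 < P $ y $ z" for y z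
    using that detailed_balance[of y z] \<pi>_nonneg[of z]
    by (metis less_eq_real_def mult_pos_pos mult_zero_left order_less_irrefl)
  ultimately have "{y. 0 < \<pi> $ y} = UNIV"
    by (intro irreducible_closed_set_eq_UNIV[OF transition irreducible, of x0]) auto
  then show ?thesis by auto
qed

lemma sum_edge_fst: "(\<Sum>x\<in>UNIV. \<Sum>y\<in>UNIV. \<pi> $ x * P $ x $ y * g x) = (\<Sum>x\<in>UNIV. \<pi> $ x * g x)"
proof -
  have "(\<Sum>y\<in>UNIV. \<pi> $ x * P $ x $ y * g x) = \<pi> $ x * g x * (\<Sum>y\<in>UNIV. P $ x $ y)" for x
    unfolding sum_distrib_left by (simp add: mult_ac)
  then show ?thesis by (simp add: P_row_sum)
qed

text \<open>Detailed balance makes the edge weights \<open>\<pi> $ x * P $ x $ y\<close> symmetric,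
  so both of their marginals are \<open>\<pi>\<close>.\<close>

lemma sum_edge_snd: "(\<Sum>x\<in>UNIV. \<Sum>y\<in>UNIV. \<pi> $ x * P $ x $ y * g y) = (\<Sum>x\<in>UNIV. \<pi> $ x * g x)"
  unfolding sum_edge_fst[symmetric] by (subst sum.swap) (simp add: detailed_balance)

text \<open>Conjugation by the square root of \<open>\<pi>\<close> turns \<open>P\<close> into a symmetric matrix.\<close>

lemma orthonormal_eigenfunctions:
  obtains f :: "'v \<Rightarrow> 'v \<Rightarrow> real" and \<mu> :: "'v \<Rightarrow> real"
  where "\<And>i x. (\<Sum>y\<in>UNIV. P $ x $ y * f i y) = (1 - \<mu> i) * f i x"
    "\<And>i j. (\<Sum>x\<in>UNIV. \<pi> $ x * f i x * f j x) = (if i = j then 1 else 0)"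
    "\<And>x y. (\<Sum>i\<in>UNIV. f i x * f i y) * \<pi> $ y = (if x = y then 1 else 0)"
proof -
  define r where "r x = sqrt (\<pi> $ x)" for x
  have r_pos: "0 < r x" and r_sq: "r x * r x = \<pi> $ x" for x
    using \<pi>_pos[of x] by (auto simp: r_def)
  define S :: "real^'v^'v" where "S = (\<chi> x y. r x * P $ x $ y / r y)"
  have "r x * P $ x $ y / r y = r y * P $ y $ x / r x" for x y
  proof -
    have "(r x * r x) * P $ x $ y = (r y * r y) * P $ y $ x"
      unfolding r_sq by (rule detailed_balance)
    then have "(r x * P $ x $ y) * r x = (r y * P $ y $ x) * r y"
      by (simp only: mult_ac)
    then show ?thesis
      using r_pos[of x] r_pos[of y] by (subst frac_eq_eq) auto
  qed
  then have "transpose S = S"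
    by (simp add: S_def transpose_def vec_eq_iff)
  then obtain u :: "'v \<Rightarrow> real^'v" and \<nu> where u: "\<And>i. S *v u i = \<nu> i *\<^sub>R u i"
    "\<And>i j. u i \<bullet> u j = (if i = j then 1 else 0)"
    "\<And>x y. (\<Sum>i\<in>UNIV. u i $ x * u i $ y) = (if x = y then 1 else 0)"
    by (rule symmetric_matrix_orthonormal_eigenvectors) (rule that)
  define f where "f i x = u i $ x / r x" for i x
  \<comment> \<open>Dividing by \<open>r\<close> carries eigenvectors of \<open>S\<close> to
    eigenfunctions of \<open>P\<close> with the same eigenvalue \<open>\<nu> i\<close>; the
    corresponding eigenvalue of I - P is \<open>1 - \<nu> i\<close>.\<close>
  show ?thesis
  proof (rule that[of f "\<lambda>i. 1 - \<nu> i"])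
    fix i x
    have "(S *v u i) $ x = r x * (\<Sum>y\<in>UNIV. P $ x $ y * f i y)"
      by (simp add: matrix_vector_mult_def S_def f_def sum_distrib_left mult.assoc)
    then show "(\<Sum>y\<in>UNIV. P $ x $ y * f i y) = (1 - (1 - \<nu> i)) * f i x"
      using r_pos[of x] unfolding u by (simp add: f_def nonzero_divide_eq_eq nonzero_eq_divide_eq mult.commute)
  next
    fix i j
    have "\<pi> $ x * f i x * f j x = u i $ x * u j $ x" for x
      using r_pos[of x] by (simp add: f_def r_sq[symmetric])
    then show "(\<Sum>x\<in>UNIV. \<pi> $ x * f i x * f j x) = (if i = j then 1 else 0)"
      using u(2)[of i j] by (simp add: inner_vec_def)
  next
    fix x y
    have "(\<Sum>i\<in>UNIV. f i x * f i y) * \<pi> $ y = r y / r x * (\<Sum>i\<in>UNIV. u i $ x * u i $ y)"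
      unfolding sum_distrib_left sum_distrib_right using r_pos[of x] r_pos[of y]
      by (intro sum.cong) (auto simp: f_def r_sq[symmetric])
    then show "(\<Sum>i\<in>UNIV. f i x * f i y) * \<pi> $ y = (if x = y then 1 else 0)"
      using r_pos[of y] by (auto simp: u(3))
  qed
qed

end

section \<open>Eigenfunctions and the simple eigenvalue 0\<close>

locale chain_eigenbasis = reversible_irreducible_chain P \<pi> for P :: "real^'v^'v" and \<pi> :: "real^'v" +
  fixes f :: "'v \<Rightarrow> 'v \<Rightarrow> real" and \<mu> :: "'v \<Rightarrow> real"
  assumes eigenfunction: "\<And>i x. (\<Sum>y\<in>UNIV. P $ x $ y * f i y) = (1 - \<mu> i) * f i x"
    and orthonormal: "\<And>i j. (\<Sum>x\<in>UNIV. \<pi> $ x * f i x * f j x) = (if i = j then 1 else 0)"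
    and complete: "\<And>x y. (\<Sum>i\<in>UNIV. f i x * f i y) * \<pi> $ y = (if x = y then 1 else 0)"
begin

text \<open>Expanding the square, each of the two square terms gives 1 by the marginals of the edge
  weights, and the cross term gives \<open>2 * (1 - \<mu> i)\<close>.\<close>

lemma dirichlet_form:
  "(\<Sum>x\<in>UNIV. \<Sum>y\<in>UNIV. \<pi> $ x * P $ x $ y * (f i x - f i y)\<^sup>2) = 2 * \<mu> i"
proof -
  have "(\<Sum>x\<in>UNIV. \<Sum>y\<in>UNIV. \<pi> $ x * P $ x $ y * (f i x - f i y)\<^sup>2)
      = (\<Sum>x\<in>UNIV. \<Sum>y\<in>UNIV. \<pi> $ x * P $ x $ y * (f i x)\<^sup>2)
      + (\<Sum>x\<in>UNIV. \<Sum>y\<in>UNIV. \<pi> $ x * P $ x $ y * (f i y)\<^sup>2)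
      - 2 * (\<Sum>x\<in>UNIV. \<Sum>y\<in>UNIV. \<pi> $ x * f i x * (P $ x $ y * f i y))"
    unfolding sum.distrib[symmetric] sum_subtractf[symmetric] sum_distrib_left
    by (intro sum.cong refl) (simp add: power2_eq_square algebra_simps)
  also have "(\<Sum>x\<in>UNIV. \<Sum>y\<in>UNIV. \<pi> $ x * f i x * (P $ x $ y * f i y))
      = (1 - \<mu> i) * (\<Sum>x\<in>UNIV. \<pi> $ x * f i x * f i x)"
    unfolding sum_distrib_left[symmetric] eigenfunction
    by (simp add: sum_distrib_left mult_ac)
  also have "(\<Sum>x\<in>UNIV. \<pi> $ x * f i x * f i x) = 1"
    by (simp add: orthonormal)
  also have "(\<Sum>x\<in>UNIV. \<Sum>y\<in>UNIV. \<pi> $ x * P $ x $ y * (f i x)\<^sup>2) = 1"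
    unfolding sum_edge_fst using orthonormal[of i i] by (simp add: power2_eq_square mult.assoc)
  also have "(\<Sum>x\<in>UNIV. \<Sum>y\<in>UNIV. \<pi> $ x * P $ x $ y * (f i y)\<^sup>2) = 1"
    unfolding sum_edge_snd using orthonormal[of i i] by (simp add: power2_eq_square mult.assoc)
  finally show ?thesis by simp
qed

lemma \<mu>_nonneg: "0 \<le> \<mu> i"
proof -
  have "0 \<le> (\<Sum>x\<in>UNIV. \<Sum>y\<in>UNIV. \<pi> $ x * P $ x $ y * (f i x - f i y)\<^sup>2)"
    using \<pi>_nonneg P_nonneg by (intro sum_nonneg) auto
  then show ?thesis by (simp add: dirichlet_form)
qed

text \<open>Zero Dirichlet energy forces equal values across every edge, so each level set of
  \<open>f i\<close> is closed under transitions.\<close>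

lemma eigenfunction_constant:
  assumes "\<mu> i = 0"
  shows "f i x = f i y"
proof -
  have "(\<Sum>x\<in>UNIV. \<Sum>y\<in>UNIV. \<pi> $ x * P $ x $ y * (f i x - f i y)\<^sup>2) = 0"
    using assms dirichlet_form[of i] by simp
  then have zero: "\<pi> $ x * P $ x $ y * (f i x - f i y)\<^sup>2 = 0" for x y
    using \<pi>_nonneg P_nonneg by (subst (asm) sum_nonneg_eq_0_iff) (auto simp: sum_nonneg_eq_0_iff sum_nonneg)
  have "{z. f i z = f i x} = UNIV"
    using zero \<pi>_pos by (intro irreducible_closed_set_eq_UNIV[OF transition irreducible, of x])
      (auto, metis eq_iff_diff_eq_0 mult_eq_0_iff order_less_irrefl power2_eq_square)
  then have "y \<in> {z. f i z = f i x}" by (simp only: UNIV_I)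
  then show ?thesis by simp
qed

lemma f_sq_of_zero:
  assumes "\<mu> i = 0"
  shows "(f i x)\<^sup>2 = 1"
proof -
  have eq: "\<pi> $ y * f i y * f i y = \<pi> $ y * (f i x)\<^sup>2" for y
    using eigenfunction_constant[OF assms, of y x] by (simp add: power2_eq_square)
  have "(\<Sum>y\<in>UNIV. \<pi> $ y * f i y * f i y) = (\<Sum>y\<in>UNIV. \<pi> $ y) * (f i x)\<^sup>2"
    by (simp only: eq sum_distrib_right)
  then show ?thesis
    using orthonormal[of i i] by (simp add: \<pi>_sum)
qed

text \<open>Two nonzero constant functions cannot be orthogonal.\<close>

lemma zero_unique:
  assumes "\<mu> i = 0" "\<mu> j = 0"
  shows "i = j"
proof (rule ccontr)
  assume "i \<noteq> j"
  fix x0 :: 'v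
  have eq: "\<pi> $ y * f i y * f j y = \<pi> $ y * (f i x0 * f j x0)" for y
    using eigenfunction_constant[OF assms(1), of y x0] eigenfunction_constant[OF assms(2), of y x0]
    by simp
  have "(\<Sum>y\<in>UNIV. \<pi> $ y * f i y * f j y) = (\<Sum>y\<in>UNIV. \<pi> $ y) * (f i x0 * f j x0)"
    by (simp only: eq sum_distrib_right)
  then have "f i x0 * f j x0 = 0"
    using orthonormal[of i j] \<open>i \<noteq> j\<close> by (simp add: \<pi>_sum)
  then show False
    using f_sq_of_zero[OF assms(1), of x0] f_sq_of_zero[OF assms(2), of x0] by auto
qed

text \<open>Otherwise invariance of \<open>\<pi>\<close> gives every eigenfunction mean 0, and the
  constant function 1, expanded by completeness, would vanish.\<close>

lemma zero_exists: "\<exists>i. \<mu> i = 0"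
proof (rule ccontr)
  assume nz: "\<nexists>i. \<mu> i = 0"
  have mean: "(\<Sum>x\<in>UNIV. \<pi> $ x * f i x) = 0" for i
  proof -
    have "(\<Sum>x\<in>UNIV. \<pi> $ x * f i x) = (\<Sum>x\<in>UNIV. \<pi> $ x * (\<Sum>y\<in>UNIV. P $ x $ y * f i y))"
      by (subst sum_edge_snd[of "f i", symmetric]) (simp add: sum_distrib_left mult.assoc)
    also have "\<dots> = (1 - \<mu> i) * (\<Sum>x\<in>UNIV. \<pi> $ x * f i x)"
      unfolding eigenfunction by (simp add: sum_distrib_left mult_ac)
    finally show ?thesis using nz by (auto simp: algebra_simps)
  qed
  fix x0 :: 'v
  have "1 = (\<Sum>y\<in>UNIV. (\<Sum>i\<in>UNIV. f i x0 * f i y) * \<pi> $ y)"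
    unfolding complete by simp
  also have "\<dots> = (\<Sum>i\<in>UNIV. f i x0 * (\<Sum>y\<in>UNIV. \<pi> $ y * f i y))"
    unfolding sum_distrib_left sum_distrib_right by (subst sum.swap) (simp add: mult_ac)
  also have "\<dots> = 0"
    by (simp add: mean)
  finally show False by simp
qed

definition base :: 'v where "base = (THE i. \<mu> i = 0)"

lemma \<mu>_eq_0_iff: "\<mu> i = 0 \<longleftrightarrow> i = base"
  unfolding base_def using zero_exists zero_unique by (metis (mono_tags) the_equality)

lemma \<mu>_pos: "i \<noteq> base \<Longrightarrow> 0 < \<mu> i"
  using \<mu>_nonneg[of i] \<mu>_eq_0_iff[of i] by auto

lemma card_nonbase: "card (-{base}) = CARD('v) - 1"
  unfolding Compl_eq_Diff_UNIV by (rule card_Diff_singleton) simp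

lemma f_base_mult: "f base x * f base y = 1"
  using f_sq_of_zero[of base x] eigenfunction_constant[of base x y]
  by (simp add: \<mu>_eq_0_iff power2_eq_square)

section \<open>Spectral formulas for the heat kernel and its integrals\<close>

definition M :: "real^'v^'v" where "M = (\<chi> x i. f i x)"
text \<open>The transpose of \<open>M\<close> weighted by \<open>\<pi>\<close>: orthonormality is
  with respect to \<open>\<pi>\<close>, so this is the inverse of \<open>M\<close>.\<close>

definition N :: "real^'v^'v" where "N = (\<chi> i x. f i x * \<pi> $ x)"

lemma M_mult_N: "M ** N = mat 1"
  using complete by (simp add: M_def N_def matrix_matrix_mult_def vec_eq_iff mat_def
      sum_distrib_right mult.assoc)

lemma laplacian_eigenvectors:
  "(\<Sum>z\<in>UNIV. (mat 1 - P) $ x $ z * M $ z $ i) = \<mu> i * M $ x $ i"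
proof -
  have "(\<Sum>z\<in>UNIV. (mat 1 - P) $ x $ z * M $ z $ i)
      = (\<Sum>z\<in>UNIV. if x = z then f i z else 0) - (\<Sum>z\<in>UNIV. P $ x $ z * f i z)"
    unfolding sum_subtractf[symmetric] by (intro sum.cong) (auto simp: mat_def M_def algebra_simps)
  also have "\<dots> = \<mu> i * M $ x $ i"
    unfolding eigenfunction by (simp add: M_def algebra_simps)
  finally show ?thesis .
qed

text \<open>Diagonalisation of I - P, scaled by \<open>- t\<close>. The summand at
  \<open>base\<close> is split off as the 1, so the remaining sum is the relative deviation from
  \<open>\<pi>\<close>.\<close>

lemma heat_kernel_expansion:
  "heat_kernel P t $ x $ y = \<pi> $ y * (1 + (\<Sum>i\<in>-{base}. exp (- (\<mu> i * t)) * (f i x * f i y)))"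
proof -
  have "(\<Sum>z\<in>UNIV. ((- t) *\<^sub>R (mat 1 - P)) $ x $ z * M $ z $ i) = (- t * \<mu> i) * M $ x $ i" for x i
    using laplacian_eigenvectors[of x i] by (simp add: sum_negf sum_distrib_left[symmetric] mult.assoc)
  from matrix_exp_diagonalizable[OF this M_mult_N]
  have "heat_kernel P t $ x $ y = (\<Sum>i\<in>UNIV. exp (- t * \<mu> i) * (M $ x $ i * N $ i $ y))"
    by (simp add: heat_kernel_def)
  also have "\<dots> = \<pi> $ y * (\<Sum>i\<in>UNIV. exp (- (\<mu> i * t)) * (f i x * f i y))"
    by (simp add: M_def N_def sum_distrib_left mult_ac)
  also have "(\<Sum>i\<in>UNIV. exp (- (\<mu> i * t)) * (f i x * f i y))
      = 1 + (\<Sum>i\<in>-{base}. exp (- (\<mu> i * t)) * (f i x * f i y))"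
    by (subst sum.remove[of _ base]) (auto simp: f_base_mult \<mu>_eq_0_iff[THEN iffD2] Compl_eq_Diff_UNIV)
  finally show ?thesis .
qed

lemma heat_kernel_trace:
  "(\<Sum>x\<in>UNIV. heat_kernel P t $ x $ x) = 1 + (\<Sum>i\<in>-{base}. exp (- (\<mu> i * t)))"
proof -
  have "(\<Sum>x\<in>UNIV. heat_kernel P t $ x $ x)
      = (\<Sum>x\<in>UNIV. \<pi> $ x) + (\<Sum>i\<in>-{base}. exp (- (\<mu> i * t)) * (\<Sum>x\<in>UNIV. \<pi> $ x * f i x * f i x))"
    unfolding heat_kernel_expansion distrib_left sum.distrib sum_distrib_left
    by (subst sum.swap) (simp add: mult_ac)
  then show ?thesis
    by (simp add: \<pi>_sum orthonormal)
qed

lemma sigma_at_expansion: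
  assumes "l \<ge> 1"
  shows "sigma_at \<pi> P x l = (\<Sum>i\<in>-{base}. (f i x)\<^sup>2 / \<mu> i ^ l)"
proof -
  have int: "set_integrable lborel {0..} (\<lambda>s. s ^ (l - 1) * exp (- (\<mu> i * s)))"
    and val: "(LBINT s:{0..}. s ^ (l - 1) * exp (- (\<mu> i * s))) = fact (l - 1) / \<mu> i ^ l"
    if "i \<in> -{base}" for i
    using integral_power_times_exp[OF \<mu>_pos assms, of i] that by auto
  \<comment> \<open>Subtracting \<open>\<pi> $ x\<close> removes the summand at \<open>base\<close>,
    which has no decay; all others decay exponentially, and the finite sum may be integrated
    termwise.\<close>
  have eq: "s ^ (l - 1) * (heat_kernel P s $ x $ x - \<pi> $ x) / (fact (l - 1) * \<pi> $ x)
      = (\<Sum>i\<in>-{base}. (f i x)\<^sup>2 / fact (l - 1) * (s ^ (l - 1) * exp (- (\<mu> i * s))))" for s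
    using \<pi>_pos[of x]
    by (simp add: heat_kernel_expansion distrib_left sum_distrib_left sum_divide_distrib
        power2_eq_square mult_ac)
  have "sigma_at \<pi> P x l
      = (\<Sum>i\<in>-{base}. (LBINT s:{0..}. (f i x)\<^sup>2 / fact (l - 1) * (s ^ (l - 1) * exp (- (\<mu> i * s)))))"
    unfolding sigma_at_def eq set_lebesgue_integral_def scaleR_sum_right
  proof (rule Bochner_Integration.integral_sum)
    fix i assume "i \<in> -{base}"
    then have "set_integrable lborel {0..}
        (\<lambda>s. (f i x)\<^sup>2 / fact (l - 1) * (s ^ (l - 1) * exp (- (\<mu> i * s))))"
      by (intro set_integrable_mult_right int)
    then show "integrable lborel (\<lambda>s. indicator {0..} s *\<^sub>R
        ((f i x)\<^sup>2 / fact (l - 1) * (s ^ (l - 1) * exp (- (\<mu> i * s)))))"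
      unfolding set_integrable_def .
  qed
  also have "\<dots> = (\<Sum>i\<in>-{base}. (f i x)\<^sup>2 / \<mu> i ^ l)"
    by (intro sum.cong refl) (simp add: val[unfolded One_nat_def])
  finally show ?thesis .
qed

section \<open>The ordered eigenvalues and the relaxation time\<close>

lemma eigenvalue_list_eq:
  "eigenvalue_list (mat 1 - P) = 0 # sorted_list_of_multiset (image_mset \<mu> (mset_set (-{base})))"
proof -
  have "proots (characteristic_poly (mat 1 - P)) = (\<Sum>i\<in>UNIV. {#\<mu> i#})"
    by (subst characteristic_poly_diagonalizable[OF laplacian_eigenvectors M_mult_N])
      (simp add: proots_prod)
  also have "\<dots> = add_mset 0 (\<Sum>i\<in>-{base}. {#\<mu> i#})"
    by (subst sum.remove[of _ base]) (auto simp: \<mu>_eq_0_iff[THEN iffD2] Compl_eq_Diff_UNIV)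
  also have "(\<Sum>i\<in>-{base}. {#\<mu> i#}) = image_mset \<mu> (mset_set (-{base}))"
    by (simp add: sum_unfold_sum_mset)
  \<comment> \<open>Nonnegativity of the other eigenvalues puts the inserted 0 at the front of the
    sorted list.\<close>
  finally show ?thesis
    using \<mu>_nonneg by (simp add: eigenvalue_list_def insort_is_Cons)
qed

lemma Q_sum_expansion: "Q_sum P l = (\<Sum>i\<in>-{base}. 1 / \<mu> i ^ l)"
proof -
  define ys where "ys = sorted_list_of_multiset (image_mset \<mu> (mset_set (-{base})))"
  have mset_ys: "mset ys = image_mset \<mu> (mset_set (-{base}))"
    by (simp add: ys_def)
  have list_eq: "eigenvalue_list (mat 1 - P) = 0 # ys"
    unfolding ys_def by (rule eigenvalue_list_eq)
  have "length ys = CARD('v) - 1"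
    using arg_cong[OF mset_ys, of size] by (simp add: card_nonbase)
  \<comment> \<open>\<open>eigval P i\<close> reads position \<open>i - 1\<close> of
    \<open>0 # ys\<close>, so \<open>i = j + 2\<close> reads \<open>ys ! j\<close>. The order of
    \<open>ys\<close> is then forgotten by passing to multisets.\<close>
  then have "Q_sum P l = (\<Sum>j<length ys. 1 / eigval P (j + 2) ^ l)"
    unfolding Q_sum_def
    by (intro sum.reindex_bij_witness[of _ "\<lambda>j. j + 2" "\<lambda>i. i - 2"])
      (auto simp del: add_2_eq_Suc')
  also have "\<dots> = (\<Sum>j<length ys. 1 / (ys ! j) ^ l)"
    by (simp add: eigval_def list_eq)
  also have "\<dots> = sum_list (map (\<lambda>y. 1 / y ^ l) ys)"
    by (simp add: sum_list_sum_nth atLeast0LessThan)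
  also have "\<dots> = sum_mset (image_mset (\<lambda>y. 1 / y ^ l) (mset ys))"
    by (simp only: mset_map[symmetric] sum_mset_sum_list)
  also have "\<dots> = (\<Sum>i\<in>-{base}. 1 / \<mu> i ^ l)"
    by (simp add: mset_ys sum_unfold_sum_mset multiset.map_comp comp_def)
  finally show ?thesis .
qed

text \<open>With at least two states the sorted tail after the leading 0 is nonempty; its head is
  \<open>eigval P 2\<close>, the least \<open>\<mu> i\<close> off \<open>base\<close>.\<close>

lemma
  assumes "CARD('v) \<ge> 2"
  shows t_rel_pos: "t_rel P > 0"
    and eigenvalue_mult_t_rel_ge_1: "\<And>i. i \<noteq> base \<Longrightarrow> 1 \<le> \<mu> i * t_rel P"
proof -
  let ?ys = "sorted_list_of_multiset (image_mset \<mu> (mset_set (-{base})))"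
  have "card (-{base}) \<noteq> 0"
    using assms by (simp add: card_nonbase)
  then have "set ?ys \<noteq> {}"
    by (auto simp: card_eq_0_iff)
  then obtain y ys where ys: "?ys = y # ys"
    by (cases ?ys) auto
  then have ev: "eigval P 2 = y"
    by (simp add: eigval_def eigenvalue_list_eq)
  have set_eq: "set (y # ys) = \<mu> ` (-{base})"
    by (simp flip: ys)
  then have "y > 0"
  proof -
    have "y \<in> \<mu> ` (-{base})"
      unfolding set_eq[symmetric] by simp
    then show ?thesis
      using \<mu>_pos by auto
  qed
  have "sorted (y # ys)"
    by (metis ys sorted_sorted_list_of_multiset)
  then have min: "y \<le> \<mu> i" if "i \<noteq> base" for i
  proof -
    have "\<mu> i \<in> set (y # ys)"
      unfolding set_eq using that by auto
    then show ?thesis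
      using \<open>sorted (y # ys)\<close> by auto
  qed
  show "t_rel P > 0"
    using \<open>y > 0\<close> by (simp add: t_rel_def ev)
  show "1 \<le> \<mu> i * t_rel P" if "i \<noteq> base" for i
    using min[OF that] \<open>y > 0\<close> by (simp add: t_rel_def ev)
qed

end

section \<open>Mixing time bounds\<close>

text \<open>Follows from \<open>ln u \<le> u - 1\<close>. It is applied with
  \<open>u = \<mu> i * t_rel P\<close> and \<open>T = t / t_rel P\<close>.\<close>

lemma exp_decay_le_power:
  fixes u T :: real
  assumes "u \<ge> 1" "T \<ge> real l"
  shows "exp (- (u * T)) \<le> exp (- T) / u ^ l"
proof -
  have "real l * ln u \<le> T * (u - 1)"
    using assms ln_le_minus_one[of u] by (intro mult_mono) auto
  then have "exp (real l * ln u) \<le> exp (u * T - T)"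
    by (simp add: algebra_simps)
  then have "u ^ l \<le> exp (u * T - T)"
    using assms by (simp add: exp_of_nat_mult)
  then show ?thesis
    using assms by (simp add: field_simps exp_diff exp_minus)
qed

lemma exp_minus_mult_le:
  fixes y T e :: real
  assumes "e > 0" "T \<ge> ln (inverse e * y)"
  shows "exp (- T) * y \<le> e"
proof (cases "y > 0")
  case True
  then have "inverse e * y = exp (ln (inverse e * y))"
    using assms by simp
  also have "\<dots> \<le> exp T"
    using assms by simp
  finally have "inverse e * y \<le> exp T" .
  then show ?thesis
    using assms by (simp add: field_simps exp_minus)
next
  \<comment> \<open>The logarithm gives no information here, but the left-hand side is nonpositive.
    Hence positivity of the spectral sums need not be shown separately.\<close>
  case False
  then have "exp (- T) * y \<le> 0"
    by (simp add: mult_nonneg_nonpos)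
  then show ?thesis using assms by simp
qed

context chain_eigenbasis
begin

lemma exp_eigenvalue_le:
  assumes "CARD('v) \<ge> 2" "i \<noteq> base" "t \<ge> real l * t_rel P"
  shows "exp (- (\<mu> i * t)) \<le> exp (- (t / t_rel P)) / t_rel P ^ l * (1 / \<mu> i ^ l)"
proof -
  have tr: "t_rel P > 0" "1 \<le> \<mu> i * t_rel P"
    using t_rel_pos eigenvalue_mult_t_rel_ge_1 assms by auto
  have "real l \<le> t / t_rel P"
    using tr assms by (simp add: field_simps)
  from exp_decay_le_power[OF tr(2) this] show ?thesis
    using tr by (simp add: power_mult_distrib mult_ac)
qed

lemma heat_kernel_diag_le:
  assumes "CARD('v) \<ge> 2" "l \<ge> 1" "t \<ge> real l * t_rel P"
  shows "heat_kernel P t $ x $ x / \<pi> $ x - 1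
      \<le> exp (- (t / t_rel P)) * (sigma_at \<pi> P x l / t_rel P ^ l)"
proof -
  have "heat_kernel P t $ x $ x / \<pi> $ x - 1 = (\<Sum>i\<in>-{base}. exp (- (\<mu> i * t)) * (f i x)\<^sup>2)"
    using \<pi>_pos[of x] by (simp add: heat_kernel_expansion power2_eq_square)
  also have "\<dots> \<le> (\<Sum>i\<in>-{base}. exp (- (t / t_rel P)) / t_rel P ^ l * (1 / \<mu> i ^ l) * (f i x)\<^sup>2)"
    using assms by (intro sum_mono mult_right_mono exp_eigenvalue_le) auto
  also have "\<dots> = exp (- (t / t_rel P)) * (sigma_at \<pi> P x l / t_rel P ^ l)"
    using assms by (simp add: sigma_at_expansion sum_distrib_left sum_divide_distrib mult.commute[of "t_rel P ^ l"])
  finally show ?thesis .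
qed

text \<open>Termwise \<open>\<bar>a * b\<bar> \<le> (a * a + b * b) / 2\<close> in the spectral sum,
  whose exponential weights are positive.\<close>

lemma heat_kernel_offdiag_le:
  "\<bar>heat_kernel P t $ x $ y / \<pi> $ y - 1\<bar>
    \<le> ((heat_kernel P t $ x $ x / \<pi> $ x - 1) + (heat_kernel P t $ y $ y / \<pi> $ y - 1)) / 2"
proof -
  have "\<bar>a * b\<bar> \<le> (a * a + b * b) / 2" for a b :: real
    using sum_squares_bound[of "\<bar>a\<bar>" "\<bar>b\<bar>"] by (simp add: abs_mult power2_eq_square)
  then have "\<bar>\<Sum>i\<in>-{base}. exp (- (\<mu> i * t)) * (f i x * f i y)\<bar>
      \<le> (\<Sum>i\<in>-{base}. exp (- (\<mu> i * t)) * ((f i x * f i x + f i y * f i y) / 2))"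
    by (intro order_trans[OF sum_abs] sum_mono) (simp only: abs_mult abs_exp_cancel mult_left_mono exp_ge_zero)
  also have "\<dots> = ((\<Sum>i\<in>-{base}. exp (- (\<mu> i * t)) * (f i x * f i x))
      + (\<Sum>i\<in>-{base}. exp (- (\<mu> i * t)) * (f i y * f i y))) / 2"
    by (simp add: sum.distrib distrib_left sum_divide_distrib add_divide_distrib)
  finally show ?thesis
    using \<pi>_pos[of x] \<pi>_pos[of y] by (simp add: heat_kernel_expansion)
qed

lemma heat_kernel_trace_le:
  assumes "CARD('v) \<ge> 2" "t \<ge> real l * t_rel P"
  shows "(\<Sum>x\<in>UNIV. heat_kernel P t $ x $ x) \<le> 1 + exp (- (t / t_rel P)) * (Q_sum P l / t_rel P ^ l)"
proof -
  have "(\<Sum>i\<in>-{base}. exp (- (\<mu> i * t)))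
      \<le> (\<Sum>i\<in>-{base}. exp (- (t / t_rel P)) / t_rel P ^ l * (1 / \<mu> i ^ l))"
    using assms by (intro sum_mono exp_eigenvalue_le) auto
  also have "\<dots> = exp (- (t / t_rel P)) * (Q_sum P l / t_rel P ^ l)"
    by (simp add: Q_sum_expansion sum_distrib_left sum_divide_distrib mult.commute[of "t_rel P ^ l"])
  finally show ?thesis
    by (simp add: heat_kernel_trace)
qed

lemma t_ave_mix_2_le:
  assumes "CARD('v) \<ge> 2" "\<epsilon> > 0"
  shows "t_ave_mix_2 P \<epsilon>
    \<le> 1 / 2 * t_rel P * max (ln (inverse (\<epsilon>\<^sup>2) * Q_sum P l / t_rel P ^ l)) (real l)"
    (is "_ \<le> 1 / 2 * t_rel P * ?T")
  unfolding t_ave_mix_2_def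
\<comment> \<open>The set is bounded below by 0, so it suffices that the claimed time belongs to it.
  Its factor 1/2 cancels the doubled time in the definition, and the \<open>real l\<close> inside
  \<open>max\<close> makes it nonnegative.\<close>
proof (rule cInf_lower)
  have tr: "t_rel P > 0" using assms by (intro t_rel_pos)
  have "exp (- ?T) * (Q_sum P l / t_rel P ^ l) \<le> \<epsilon>\<^sup>2"
    using assms by (intro exp_minus_mult_le) (auto simp: algebra_simps)
  moreover have "(\<Sum>x\<in>UNIV. heat_kernel P (2 * (1 / 2 * t_rel P * ?T)) $ x $ x)
      \<le> 1 + exp (- ?T) * (Q_sum P l / t_rel P ^ l)"
    using heat_kernel_trace_le[OF assms(1), of l "t_rel P * ?T"] tr by simp
  ultimately show "1 / 2 * t_rel P * ?T
      \<in> {t. 0 \<le> t \<and> (\<Sum>x\<in>UNIV. heat_kernel P (2 * t) $ x $ x) \<le> 1 + \<epsilon>\<^sup>2}"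
    using tr by (auto intro!: mult_nonneg_nonneg max.coboundedI2)
qed (auto intro: bdd_belowI)

lemma t_mix_2_le:
  assumes "CARD('v) \<ge> 2" "l \<ge> 1" "\<epsilon> > 0"
  shows "t_mix_2 \<pi> P x \<epsilon>
    \<le> 1 / 2 * t_rel P * max (ln (inverse (\<epsilon>\<^sup>2) * sigma_at \<pi> P x l / t_rel P ^ l)) (real l)"
    (is "_ \<le> 1 / 2 * t_rel P * ?T")
  unfolding t_mix_2_def
proof (rule cInf_lower)
  have tr: "t_rel P > 0" using assms by (intro t_rel_pos)
  have "exp (- ?T) * (sigma_at \<pi> P x l / t_rel P ^ l) \<le> \<epsilon>\<^sup>2"
    using assms by (intro exp_minus_mult_le) (auto simp: algebra_simps)
  moreover have "heat_kernel P (2 * (1 / 2 * t_rel P * ?T)) $ x $ x / \<pi> $ x - 1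
      \<le> exp (- ?T) * (sigma_at \<pi> P x l / t_rel P ^ l)"
    using heat_kernel_diag_le[OF assms(1,2), of "t_rel P * ?T" x] tr by simp
  ultimately show "1 / 2 * t_rel P * ?T
      \<in> {t. 0 \<le> t \<and> heat_kernel P (2 * t) $ x $ x / \<pi> $ x - 1 \<le> \<epsilon>\<^sup>2}"
    using tr by (auto intro!: mult_nonneg_nonneg max.coboundedI2)
qed (auto intro: bdd_belowI)

text \<open>No factor 1/2 appears because the uniform distance at time t is controlled by diagonal
  entries at the same time t.\<close>

lemma t_mix_inf_le:
  assumes "CARD('v) \<ge> 2" "l \<ge> 1" "\<epsilon> > 0"
  shows "t_mix_inf \<pi> P \<epsilon>
    \<le> t_rel P * max (ln (inverse \<epsilon> * sigma_max \<pi> P l / t_rel P ^ l)) (real l)"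
    (is "_ \<le> t_rel P * ?T")
  unfolding t_mix_inf_def
proof (rule cInf_lower)
  have tr: "t_rel P > 0" using assms by (intro t_rel_pos)
  have diag: "heat_kernel P (t_rel P * ?T) $ x $ x / \<pi> $ x - 1 \<le> \<epsilon>" for x
  proof -
    have "heat_kernel P (t_rel P * ?T) $ x $ x / \<pi> $ x - 1
        \<le> exp (- ?T) * (sigma_at \<pi> P x l / t_rel P ^ l)"
      using heat_kernel_diag_le[OF assms(1,2), of "t_rel P * ?T" x] tr by simp
    also have "\<dots> \<le> exp (- ?T) * (sigma_max \<pi> P l / t_rel P ^ l)"
      using tr by (intro mult_left_mono divide_right_mono) (auto simp: sigma_max_def)
    also have "\<dots> \<le> \<epsilon>"
      using assms by (intro exp_minus_mult_le) (auto simp: algebra_simps)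
    finally show ?thesis .
  qed
  have "\<bar>heat_kernel P (t_rel P * ?T) $ a $ b / \<pi> $ b - 1\<bar> \<le> \<epsilon>" for a b
  proof -
    have "\<bar>z\<bar> \<le> \<epsilon>" if "\<bar>z\<bar> \<le> (p + q) / 2" "p \<le> \<epsilon>" "q \<le> \<epsilon>" for z p q :: real
    proof -
      have "(p + q) / 2 \<le> \<epsilon>"
        using that(2,3) by simp
      with that(1) show ?thesis by (rule order_trans)
    qed
    from this[OF heat_kernel_offdiag_le diag diag] show ?thesis .
  qed
  then have "Max (range (\<lambda>(a, b). \<bar>heat_kernel P (t_rel P * ?T) $ a $ b / \<pi> $ b - 1\<bar>)) \<le> \<epsilon>"
    by (subst Max_le_iff) auto
  then show "t_rel P * ?T
      \<in> {t. 0 \<le> t \<and> Max (range (\<lambda>(a, b). \<bar>heat_kernel P t $ a $ b / \<pi> $ b - 1\<bar>)) \<le> \<epsilon>}"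
    using tr by (auto intro!: mult_nonneg_nonneg max.coboundedI2)
qed (auto intro: bdd_belowI)

end

theorem theorem2:
  fixes P :: "real^'v^'v" and \<pi> :: "real^'v" and l :: nat
  assumes "CARD('v) \<ge> 2"
    and "transition_matrix P"
    and "irreducible_chain P"
    and "stationary_distribution \<pi> P"
    and "reversible_chain \<pi> P"
    and "l \<ge> 1"
  shows "(\<forall>\<epsilon>>0. t_ave_mix_2 P \<epsilon>
             \<le> 1 / 2 * t_rel P * max (ln (inverse (\<epsilon>\<^sup>2) * Q_sum P l / t_rel P ^ l)) (real l)) \<and>
         (\<forall>x. \<forall>\<epsilon>>0. t_mix_2 \<pi> P x \<epsilon>
             \<le> 1 / 2 * t_rel P * max (ln (inverse (\<epsilon>\<^sup>2) * sigma_at \<pi> P x l / t_rel P ^ l)) (real l)) \<and>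
         (\<forall>\<epsilon>>0. t_mix_inf \<pi> P \<epsilon>
             \<le> t_rel P * max (ln (inverse \<epsilon> * sigma_max \<pi> P l / t_rel P ^ l)) (real l))"
proof -
  interpret reversible_irreducible_chain P \<pi>
    using assms by unfold_locales
  \<comment> \<open>The bounds do not mention the basis, so any choice of one yields them.\<close>
  obtain f :: "'v \<Rightarrow> 'v \<Rightarrow> real" and \<mu> where "\<And>i x. (\<Sum>y\<in>UNIV. P $ x $ y * f i y) = (1 - \<mu> i) * f i x"
    "\<And>i j. (\<Sum>x\<in>UNIV. \<pi> $ x * f i x * f j x) = (if i = j then 1 else 0)"
    "\<And>x y. (\<Sum>i\<in>UNIV. f i x * f i y) * \<pi> $ y = (if x = y then 1 else 0)"
    by (rule orthonormal_eigenfunctions) (rule that)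
  then interpret chain_eigenbasis P \<pi> f \<mu>
    by unfold_locales
  show ?thesis
    using t_ave_mix_2_le t_mix_2_le t_mix_inf_le assms by blast
qed

end
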